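(* Let $p$ be a prime and let $G$ be a finite non-abelian $p$-group such that the center $Z(G)$ is cyclic. Then $\mathrm{Aut}_c(G)=\mathrm{Aut}_z(G)$ if and only if $Z(G)=\gamma_2(G)$.
   Context: $\gamma_2(G)$ is the commutator subgroup of $G$. $\mathrm{Aut}_c(G)$ is the group of all class preserving automorphisms of $G$, i.e. automorphisms $\alpha$ such that $\alpha(x)$ is conjugate to $x$ in $G$ for every $x\in G$. $\mathrm{Aut}_z(G)$ is the group of all central automorphisms of $G$, i.e. automorphisms $\phi$ such that $g^{-1}\phi(g)\in Z(G)$ for every $g\in G$. *)

theory Defs
  imports "HOL-Algebra.Algebra"
begin

definition center :: "('a, 'b) monoid_scheme \<Rightarrow> 'a set" where
  "center G = {z \<in> carrier G. \<forall>g \<in> carrier G. z \<otimes>\<^bsub>G\<^esub> g = g \<otimes>\<^bsub>G\<^esub> z}"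

(* Automorphisms are elements of auto G, hence extensional functions: each one is
   represented by a unique HOL function, so set equality below is equality of
   subgroups of AutoGroup G. *)

definition class_preserving_auto :: "('a, 'b) monoid_scheme \<Rightarrow> ('a \<Rightarrow> 'a) set" where
  "class_preserving_auto G =
    {\<alpha> \<in> auto G. \<forall>x \<in> carrier G. \<exists>g \<in> carrier G. \<alpha> x = inv\<^bsub>G\<^esub> g \<otimes>\<^bsub>G\<^esub> x \<otimes>\<^bsub>G\<^esub> g}"

definition central_auto :: "('a, 'b) monoid_scheme \<Rightarrow> ('a \<Rightarrow> 'a) set" where
  "central_auto G =
    {\<phi> \<in> auto G. \<forall>g \<in> carrier G. inv\<^bsub>G\<^esub> g \<otimes>\<^bsub>G\<^esub> \<phi> g \<in> center G}"

end

theory Submission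
  imports Defs
begin

text \<open>
  Both sides force the commutators to be central: inner automorphisms preserve classes.

  If \<open>Z(G) = \<gamma>\<^sub>2(G)\<close>, let \<open>\<phi>\<close> be a central automorphism and \<open>f(x) = x\<^sup>-\<^sup>1 \<phi>(x)\<close>, a homomorphism
  into \<open>Z(G)\<close>. The commutators \<open>[x, G]\<close> form a subgroup of \<open>Z(G)\<close>, of order \<open>m\<close> say; then \<open>x\<^sup>m\<close>
  is central, hence in \<open>\<gamma>\<^sub>2(G)\<close>, which \<open>f\<close> kills. So \<open>f(x)\<^sup>m = 1\<close>, and since \<open>Z(G)\<close> is cyclic its
  \<open>m\<close>-torsion is exactly \<open>[x, G]\<close>; hence \<open>\<phi>(x)\<close> is conjugate to \<open>x\<close>.

  Conversely, put \<open>k = |\<gamma>\<^sub>2(G)|\<close>, a nontrivial power of \<open>p\<close>. There is a homomorphism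
  \<open>F : G \<rightarrow> Z(G)\<close> with \<open>F(z) = z\<^sup>k\<close> on \<open>Z(G)\<close> (for odd \<open>p\<close> simply the \<open>k\<close>-th power map). As
  \<open>k + 1\<close> is prime to \<open>p\<close>, the map \<open>x \<mapsto> x F(x)\<close> is a central automorphism. Being class
  preserving, it fixes a generator \<open>a\<close> of \<open>Z(G)\<close>, so \<open>a\<^sup>k = 1\<close> and \<open>|Z(G)| \<le> |\<gamma>\<^sub>2(G)|\<close>.
\<close>

section \<open>Commutators, centralizers and the center\<close>

text \<open>The order of the factors agrees with the generators used by \<open>derived\<close>, so
  that commutators lie in \<open>derived G (carrier G)\<close> by definition.\<close>

definition commutator :: "('a, 'b) monoid_scheme \<Rightarrow> 'a \<Rightarrow> 'a \<Rightarrow> 'a" where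
  "commutator G x y = x \<otimes>\<^bsub>G\<^esub> y \<otimes>\<^bsub>G\<^esub> inv\<^bsub>G\<^esub> x \<otimes>\<^bsub>G\<^esub> inv\<^bsub>G\<^esub> y"

context group
begin

lemma inv_mult_cancel_left [simp]:
  "x \<in> carrier G \<Longrightarrow> y \<in> carrier G \<Longrightarrow> inv x \<otimes> (x \<otimes> y) = y"
  by (simp flip: m_assoc)

lemma commutator_closed [simp]:
  "x \<in> carrier G \<Longrightarrow> y \<in> carrier G \<Longrightarrow> commutator G x y \<in> carrier G"
  by (simp add: commutator_def)

lemma commutator_mult:
  "x \<in> carrier G \<Longrightarrow> y \<in> carrier G \<Longrightarrow> commutator G x y \<otimes> (y \<otimes> x) = x \<otimes> y"
  by (simp add: commutator_def m_assoc)

text \<open>Cancelling \<open>y \<otimes> x\<close> determines \<open>w\<close>. Commutator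
  identities can thus be checked without handling inverses.\<close>

lemma commutator_eqI:
  assumes "x \<in> carrier G" "y \<in> carrier G" "w \<in> carrier G" "x \<otimes> y = w \<otimes> (y \<otimes> x)"
  shows "commutator G x y = w"
  using assms commutator_mult by (metis commutator_closed m_closed r_cancel)

lemma commutator_eq_one_iff:
  assumes "x \<in> carrier G" "y \<in> carrier G"
  shows "commutator G x y = \<one> \<longleftrightarrow> x \<otimes> y = y \<otimes> x"
  using assms commutator_eqI commutator_mult by (metis l_one m_closed one_closed)

lemma inv_commutator:
  "x \<in> carrier G \<Longrightarrow> y \<in> carrier G \<Longrightarrow> inv (commutator G x y) = commutator G y x"
  by (simp add: commutator_def inv_mult_group m_assoc)

lemma commutator_mem_derived:
  "x \<in> carrier G \<Longrightarrow> y \<in> carrier G \<Longrightarrow> commutator G x y \<in> derived G (carrier G)"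
  unfolding derived_def commutator_def by (rule generate.incl) auto

lemma derived_subset_subgroup:
  assumes "subgroup H G" "\<And>x y. x \<in> carrier G \<Longrightarrow> y \<in> carrier G \<Longrightarrow> commutator G x y \<in> H"
  shows "derived G (carrier G) \<subseteq> H"
  unfolding derived_def
  by (rule generate_subgroup_incl) (use assms in \<open>auto simp: commutator_def\<close>)

text \<open>The set \<open>S\<close> is arbitrary because two cases occur: the whole carrier, which
  gives the center, and the set of \<open>T\<close>-th powers in
  \<open>ex_hom_extending_power\<close>.\<close>

lemma subgroup_centralizer:
  assumes "S \<subseteq> carrier G"
  shows "subgroup {x \<in> carrier G. \<forall>g\<in>S. x \<otimes> g = g \<otimes> x} G" (is "subgroup ?C G")
proof (rule subgroupI)
  fix a assume "a \<in> ?C"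
  then have a: "a \<in> carrier G" and c: "\<And>g. g \<in> S \<Longrightarrow> a \<otimes> g = g \<otimes> a"
    by auto
  have "inv a \<otimes> g = g \<otimes> inv a" if g: "g \<in> S" for g
  proof -
    have gG: "g \<in> carrier G" using g assms by auto
    have "inv a \<otimes> (g \<otimes> a) \<otimes> inv a = g \<otimes> inv a"
      using a gG by (simp flip: c[OF g] add: m_assoc)
    then show ?thesis using a gG by (simp add: m_assoc)
  qed
  with a show "inv a \<in> ?C" by simp
next
  fix a b assume "a \<in> ?C" "b \<in> ?C"
  then have ab: "a \<in> carrier G" "b \<in> carrier G"
    and c: "\<And>g. g \<in> S \<Longrightarrow> a \<otimes> g = g \<otimes> a" "\<And>g. g \<in> S \<Longrightarrow> b \<otimes> g = g \<otimes> b"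
    by auto
  have "a \<otimes> b \<otimes> g = g \<otimes> (a \<otimes> b)" if g: "g \<in> S" for g
  proof -
    have gG: "g \<in> carrier G" using g assms by auto
    have "a \<otimes> b \<otimes> g = a \<otimes> (g \<otimes> b)" using ab c(2)[OF g] gG by (simp add: m_assoc)
    also have "\<dots> = g \<otimes> (a \<otimes> b)" using ab c(1)[OF g] gG by (simp flip: m_assoc)
    finally show ?thesis .
  qed
  with ab show "a \<otimes> b \<in> ?C" by simp
next
  have "\<one> \<in> ?C" using assms by (simp add: subset_iff)
  then show "?C \<noteq> {}" by blast
qed (simp add: subset_iff)

lemma subgroup_center: "subgroup (center G) G"
  unfolding center_def by (rule subgroup_centralizer) simp

lemma center_carrier: "z \<in> center G \<Longrightarrow> z \<in> carrier G"
  by (simp add: center_def)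

lemma center_commute: "z \<in> center G \<Longrightarrow> g \<in> carrier G \<Longrightarrow> z \<otimes> g = g \<otimes> z"
  by (simp add: center_def)

lemma comm_group_center: "comm_group (G\<lparr>carrier := center G\<rparr>)"
  by (rule group.group_comm_groupI)
     (auto simp: subgroup_imp_group subgroup_center center_commute center_carrier)

lemma mem_center_iff:
  "x \<in> center G \<longleftrightarrow> x \<in> carrier G \<and> (\<forall>g\<in>carrier G. commutator G x g = \<one>)"
  by (auto simp: center_def commutator_eq_one_iff)

lemma subgroup_pow_card:
  assumes "subgroup H G" "x \<in> H"
  shows "x [^] card H = \<one>"
  using group.pow_order_eq_1[OF subgroup_imp_group[OF assms(1)], of x] assms
  by (simp add: order_def flip: nat_pow_consistent)

lemma subgroup_nat_pow_closed: "subgroup H G \<Longrightarrow> x \<in> H \<Longrightarrow> x [^] (n::nat) \<in> H"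
  by (induction n) (auto intro: subgroup.one_closed subgroup.m_closed)

section \<open>Extending homomorphisms by adjoining square roots\<close>

text \<open>As \<open>H\<close> contains all commutators it is normal, and as \<open>f\<close> kills
  them it is invariant under conjugation. Hence \<open>x\<close> may be sent to \<open>t\<close> on
  the union of \<open>H\<close> and its coset of \<open>x\<close>; the only relation to respect is
  the value at \<open>x \<otimes> x\<close>.\<close>

lemma hom_extend_square_root:
  assumes A: "comm_group A"
    and H: "subgroup H G"
    and f: "f \<in> hom (G\<lparr>carrier := H\<rparr>) A"
    and comm: "\<And>x y. x \<in> carrier G \<Longrightarrow> y \<in> carrier G \<Longrightarrow>
      commutator G x y \<in> H \<and> f (commutator G x y) = \<one>\<^bsub>A\<^esub>"
    and x: "x \<in> carrier G" "x \<notin> H" "x \<otimes> x \<in> H"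
    and t: "t \<in> carrier A" "f (x \<otimes> x) = t \<otimes>\<^bsub>A\<^esub> t"
  obtains H' f' where "subgroup H' G" "H \<subset> H'" "f' \<in> hom (G\<lparr>carrier := H'\<rparr>) A"
    "\<And>h. h \<in> H \<Longrightarrow> f' h = f h"
proof -
  interpret A: comm_group A by fact
  interpret H: subgroup H G by fact
  have f_closed: "f a \<in> carrier A" if "a \<in> H" for a
    using f that by (auto simp: hom_def)
  have f_mult: "f (a \<otimes> b) = f a \<otimes>\<^bsub>A\<^esub> f b" if "a \<in> H" "b \<in> H" for a b
    using f that by (auto simp: hom_def)
  have conj_H: "x \<otimes> h \<otimes> inv x \<in> H" and f_conj: "f (x \<otimes> h \<otimes> inv x) = f h" if h: "h \<in> H" for h
  proof -
    have hG: "h \<in> carrier G" using h H.subset by auto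
    have *: "x \<otimes> h \<otimes> inv x = commutator G x h \<otimes> h"
      using hG x by (simp add: commutator_def m_assoc)
    show "x \<otimes> h \<otimes> inv x \<in> H" using * comm[OF x(1) hG] h by simp
    show "f (x \<otimes> h \<otimes> inv x) = f h"
      using * comm[OF x(1) hG] h f_mult f_closed by simp
  qed
  define H' where "H' = H \<union> {h \<otimes> x | h. h \<in> H}"
  \<comment> \<open>Outside \<open>H\<close> the representative \<open>x\<close> is stripped off and
    replaced by \<open>t\<close>; only the values on \<open>H'\<close> matter.\<close>
  define f' where "f' y = (if y \<in> H then f y else f (y \<otimes> inv x) \<otimes>\<^bsub>A\<^esub> t)" for y
  have notin: "h \<otimes> x \<notin> H" if "h \<in> H" for h
  proof
    assume "h \<otimes> x \<in> H"
    then have "inv h \<otimes> (h \<otimes> x) \<in> H" using that by simp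
    moreover have "inv h \<otimes> (h \<otimes> x) = x" using that x(1) by (simp flip: m_assoc)
    ultimately show False using x(2) by simp
  qed
  have f'H: "f' h = f h" if "h \<in> H" for h using that by (simp add: f'_def)
  have f'x: "f' (h \<otimes> x) = f h \<otimes>\<^bsub>A\<^esub> t" if "h \<in> H" for h
    using notin[OF that] that x(1) by (simp add: f'_def m_assoc)
  have cases: "(\<exists>h\<in>H. y = h) \<or> (\<exists>h\<in>H. y = h \<otimes> x)" if "y \<in> H'" for y
    using that by (auto simp: H'_def)
  \<comment> \<open>These identities bring each product into the form of an element of
    \<open>H\<close>, possibly times \<open>x\<close>; moving \<open>x\<close> to the right past
    \<open>h2\<close> costs a conjugation, which \<open>f\<close> does not see.\<close>
  have e1: "h1 \<otimes> (h2 \<otimes> x) = (h1 \<otimes> h2) \<otimes> x" if "h1 \<in> H" "h2 \<in> H" for h1 h2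
    using that x(1) by (simp add: m_assoc)
  have e2: "(h1 \<otimes> x) \<otimes> h2 = (h1 \<otimes> (x \<otimes> h2 \<otimes> inv x)) \<otimes> x" if "h1 \<in> H" "h2 \<in> H" for h1 h2
    using that x(1) by (simp add: m_assoc)
  have e3: "(h1 \<otimes> x) \<otimes> (h2 \<otimes> x) = (h1 \<otimes> (x \<otimes> h2 \<otimes> inv x)) \<otimes> (x \<otimes> x)"
    if "h1 \<in> H" "h2 \<in> H" for h1 h2
    using that x(1) by (simp add: m_assoc)
  have prod: "y1 \<otimes> y2 \<in> H' \<and> f' (y1 \<otimes> y2) = f' y1 \<otimes>\<^bsub>A\<^esub> f' y2" if y: "y1 \<in> H'" "y2 \<in> H'" for y1 y2
  proof -
    consider h1 h2 where "y1 = h1" "y2 = h2" "h1 \<in> H" "h2 \<in> H"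
      | h1 h2 where "y1 = h1" "y2 = h2 \<otimes> x" "h1 \<in> H" "h2 \<in> H"
      | h1 h2 where "y1 = h1 \<otimes> x" "y2 = h2" "h1 \<in> H" "h2 \<in> H"
      | h1 h2 where "y1 = h1 \<otimes> x" "y2 = h2 \<otimes> x" "h1 \<in> H" "h2 \<in> H"
      using cases[OF y(1)] cases[OF y(2)] by blast
    then show ?thesis
    proof cases
      case 1
      then show ?thesis by (simp add: f'H f_mult) (simp add: H'_def)
    next
      case 2
      then have "h1 \<otimes> h2 \<in> H" by simp
      with 2 show ?thesis
        by (simp only: e1 f'x f'H f_mult) (auto simp add: H'_def A.m_assoc f_closed t)
    next
      case 3
      then have "h1 \<otimes> (x \<otimes> h2 \<otimes> inv x) \<in> H" by (simp add: conj_H)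
      with 3 show ?thesis
        by (simp only: e2 f'x f'H f_mult f_conj conj_H)
           (auto simp add: H'_def A.m_ac f_closed t)
    next
      case 4
      then have h: "h1 \<otimes> (x \<otimes> h2 \<otimes> inv x) \<in> H" by (simp add: conj_H)
      have y12: "y1 \<otimes> y2 = h1 \<otimes> (x \<otimes> h2 \<otimes> inv x) \<otimes> (x \<otimes> x)"
        unfolding 4(1,2) using 4(3,4) by (rule e3)
      then have "y1 \<otimes> y2 \<in> H" using h x(3) by simp
      then have "f' (y1 \<otimes> y2) = f h1 \<otimes>\<^bsub>A\<^esub> f h2 \<otimes>\<^bsub>A\<^esub> (t \<otimes>\<^bsub>A\<^esub> t)"
        using y12 f_mult[OF h x(3)] f_mult[OF 4(3) conj_H[OF 4(4)]] f_conj[OF 4(4)] f'H t(2)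
        by metis
      also have "\<dots> = f' y1 \<otimes>\<^bsub>A\<^esub> f' y2"
        using 4 f_closed t(1) by (simp add: f'x A.m_ac)
      finally show ?thesis using \<open>y1 \<otimes> y2 \<in> H\<close> by (simp add: H'_def)
    qed
  qed
  have "subgroup H' G"
  proof (rule subgroupI)
    show "H' \<subseteq> carrier G" using x(1) by (auto simp: H'_def)
    show "H' \<noteq> {}" using H.one_closed unfolding H'_def by blast
    fix y assume y: "y \<in> H'"
    show "inv y \<in> H'"
    proof (cases "y \<in> H")
      case True then show ?thesis by (simp add: H'_def)
    next
      case False
      then obtain h where h: "h \<in> H" "y = h \<otimes> x" using cases[OF y] by blast
      \<comment> \<open>The inverse of \<open>h \<otimes> x\<close> must again have \<open>x\<close>
        as its right factor; inserting the square of \<open>x\<close>, which lies in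
        \<open>H\<close>, achieves this.\<close>
      have "inv (x \<otimes> x) \<otimes> (x \<otimes> inv h \<otimes> inv x) \<otimes> x = inv y"
        using h x(1) by (simp add: inv_mult_group m_assoc)
      moreover have "inv (x \<otimes> x) \<otimes> (x \<otimes> inv h \<otimes> inv x) \<in> H"
        using h x(3) conj_H by (meson H.m_closed H.m_inv_closed)
      ultimately show ?thesis unfolding H'_def by (metis (mono_tags, lifting) UnI2 mem_Collect_eq)
    qed
  qed (use prod in blast)
  moreover have "H \<subset> H'"
  proof -
    have "\<one> \<otimes> x \<in> H'" using H.one_closed unfolding H'_def by blast
    then have "x \<in> H'" using x(1) by simp
    then show ?thesis using x(2) unfolding H'_def by blast
  qed
  moreover have "f' \<in> hom (G\<lparr>carrier := H'\<rparr>) A"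
  proof -
    have "f' y \<in> carrier A" if "y \<in> H'" for y
      using cases[OF that]
    proof (elim disjE bexE)
      fix h assume "h \<in> H" "y = h"
      then show ?thesis using f'H f_closed by simp
    next
      fix h assume "h \<in> H" "y = h \<otimes> x"
      then show ?thesis using f'x f_closed t(1) by simp
    qed
    then show ?thesis using prod unfolding hom_def by auto
  qed
  ultimately show ?thesis using that f'H by blast
qed

text \<open>Adjoin one missing element after another, by induction on the number of elements outside
  \<open>H\<close>. The hypotheses survive because all commutators and squares lie in
  \<open>H\<close>, where the extension agrees with \<open>f\<close>.\<close>

lemma hom_extend_squares:
  assumes A: "comm_group A" and fin: "finite (carrier G)"
    and H: "subgroup H G"
    and f: "f \<in> hom (G\<lparr>carrier := H\<rparr>) A"
    and comm: "\<And>x y. x \<in> carrier G \<Longrightarrow> y \<in> carrier G \<Longrightarrow>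
      commutator G x y \<in> H \<and> f (commutator G x y) = \<one>\<^bsub>A\<^esub>"
    and sq: "\<And>x. x \<in> carrier G \<Longrightarrow>
      x \<otimes> x \<in> H \<and> (\<exists>t\<in>carrier A. f (x \<otimes> x) = t \<otimes>\<^bsub>A\<^esub> t)"
  shows "\<exists>F\<in>hom G A. \<forall>h\<in>H. F h = f h"
  using H f comm sq
proof (induction "card (carrier G - H)" arbitrary: H f rule: less_induct)
  case less
  show ?case
  proof (cases "H = carrier G")
    case True
    then show ?thesis using less.prems(2) by auto
  next
    case False
    then obtain x where x: "x \<in> carrier G" "x \<notin> H"
      using subgroup.subset[OF less.prems(1)] by blast
    obtain t where t: "t \<in> carrier A" "f (x \<otimes> x) = t \<otimes>\<^bsub>A\<^esub> t" and xx: "x \<otimes> x \<in> H"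
      using less.prems(4)[OF x(1)] by blast
    obtain H' f' where H': "subgroup H' G" "H \<subset> H'" "f' \<in> hom (G\<lparr>carrier := H'\<rparr>) A"
      and eq: "\<And>h. h \<in> H \<Longrightarrow> f' h = f h"
      using hom_extend_square_root[OF A less.prems(1,2,3) x xx t] by metis
    have "carrier G - H' \<subset> carrier G - H"
      using H'(2) subgroup.subset[OF H'(1)] by blast
    then have "card (carrier G - H') < card (carrier G - H)"
      using fin by (simp add: psubset_card_mono)
    moreover have "commutator G x y \<in> H' \<and> f' (commutator G x y) = \<one>\<^bsub>A\<^esub>"
      if "x \<in> carrier G" "y \<in> carrier G" for x y
      using less.prems(3)[OF that] H'(2) eq by auto
    moreover have "x \<otimes> x \<in> H' \<and> (\<exists>t\<in>carrier A. f' (x \<otimes> x) = t \<otimes>\<^bsub>A\<^esub> t)"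
      if "x \<in> carrier G" for x
      using less.prems(4)[OF that] H'(2) eq by auto
    ultimately obtain F where "F \<in> hom G A" "\<forall>h\<in>H'. F h = f' h"
      using less.hyps[of H' f'] H'(1,3) by blast
    then show ?thesis using H'(2) eq by (intro bexI[of _ F]) auto
  qed
qed

end

section \<open>Commutator calculus in nilpotency class at most two\<close>

locale class_two_group = group +
  assumes commutator_central:
    "x \<in> carrier G \<Longrightarrow> y \<in> carrier G \<Longrightarrow> commutator G x y \<in> center G"
begin

text \<open>Moving \<open>g\<close> to the left past \<open>y\<close> and then past \<open>x\<close>
  produces one commutator each time, and both are central, so they can be collected in
  front.\<close>

lemma commutator_mult_left:
  assumes "x \<in> carrier G" "y \<in> carrier G" "g \<in> carrier G"
  shows "commutator G (x \<otimes> y) g = commutator G x g \<otimes> commutator G y g"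
proof (rule commutator_eqI)
  let ?c = "commutator G x g" and ?d = "commutator G y g"
  have cl: "?c \<in> carrier G" "?d \<in> carrier G" using assms by auto
  have "x \<otimes> y \<otimes> g = x \<otimes> (?d \<otimes> (g \<otimes> y))"
    using assms by (simp add: commutator_mult m_assoc)
  also have "\<dots> = ?d \<otimes> (x \<otimes> g) \<otimes> y"
    using center_commute[OF commutator_central[OF assms(2,3)] assms(1)] assms cl
    by (simp flip: m_assoc)
  also have "\<dots> = ?d \<otimes> (?c \<otimes> (g \<otimes> x)) \<otimes> y"
    using assms by (simp add: commutator_mult)
  also have "\<dots> = ?c \<otimes> ?d \<otimes> (g \<otimes> (x \<otimes> y))"
    using center_commute[OF commutator_central[OF assms(2,3)] cl(1)] assms cl
    by (simp flip: m_assoc)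
  finally show "x \<otimes> y \<otimes> g = ?c \<otimes> ?d \<otimes> (g \<otimes> (x \<otimes> y))" .
qed (use assms in auto)

lemma commutator_pow_left:
  assumes "x \<in> carrier G" "g \<in> carrier G"
  shows "commutator G (x [^] (n::nat)) g = commutator G x g [^] n"
proof (induction n)
  case 0
  show ?case using assms by (simp add: commutator_eq_one_iff)
next
  case (Suc n)
  then show ?case using assms by (simp add: commutator_mult_left)
qed

lemma commutator_mult_right:
  assumes "x \<in> carrier G" "y \<in> carrier G" "g \<in> carrier G"
  shows "commutator G g (x \<otimes> y) = commutator G g x \<otimes> commutator G g y"
proof -
  have "commutator G g (x \<otimes> y) = inv (commutator G x g \<otimes> commutator G y g)"
    using assms inv_commutator[of "x \<otimes> y" g] by (simp add: commutator_mult_left)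
  also have "\<dots> = commutator G g y \<otimes> commutator G g x"
    using assms by (simp add: inv_mult_group inv_commutator)
  finally show ?thesis
    using assms center_commute[OF commutator_central, of g y] by simp
qed

text \<open>In the step from \<open>n\<close> to \<open>n + 1\<close>, the new \<open>x\<close>
  moves left past \<open>y [^] n\<close> and leaves \<open>n\<close> copies of the central
  commutator; the exponent is the sum of the numbers below \<open>n\<close>.\<close>

lemma pow_mult:
  assumes x: "x \<in> carrier G" and y: "y \<in> carrier G"
  shows "(x \<otimes> y) [^] (n::nat) = x [^] n \<otimes> y [^] n \<otimes> commutator G y x [^] (n * (n - 1) div 2)"
proof (induction n)
  case 0
  show ?case by simp
next
  case (Suc n)
  let ?c = "commutator G y x"
  have c: "?c \<in> carrier G" using x y by simp
  have cc: "?c [^] (m::nat) \<otimes> g = g \<otimes> ?c [^] m" if "g \<in> carrier G" for m g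
    using that center_commute subgroup_nat_pow_closed[OF subgroup_center commutator_central[OF y x]]
    by blast
  have yx: "y [^] n \<otimes> x = ?c [^] n \<otimes> (x \<otimes> y [^] n)"
    using commutator_mult[of "y [^] n" x] x y by (simp add: commutator_pow_left)
  let ?T = "n * (n - 1) div 2"
  have T: "Suc n * (Suc n - 1) div 2 = n + ?T"
    by (cases n) (auto simp: algebra_simps)
  have "(x \<otimes> y) [^] Suc n = x [^] n \<otimes> y [^] n \<otimes> (?c [^] ?T \<otimes> (x \<otimes> y))"
    using x y Suc by (simp add: m_assoc)
  also have "\<dots> = x [^] n \<otimes> (y [^] n \<otimes> x) \<otimes> y \<otimes> ?c [^] ?T"
    using x y c cc[of "x \<otimes> y"] by (simp add: m_assoc)
  also have "\<dots> = x [^] n \<otimes> (?c [^] n \<otimes> (x \<otimes> y [^] n \<otimes> y)) \<otimes> ?c [^] ?T"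
    using x y c yx by (simp add: m_assoc)
  also have "\<dots> = x [^] n \<otimes> (x \<otimes> y [^] n \<otimes> y) \<otimes> (?c [^] n \<otimes> ?c [^] ?T)"
    using x y c cc[of "x \<otimes> y [^] n \<otimes> y" n] by (simp add: m_assoc)
  also have "\<dots> = x [^] Suc n \<otimes> y [^] Suc n \<otimes> ?c [^] (n + ?T)"
    using x y c by (simp add: m_assoc nat_pow_mult)
  finally show ?case by (simp only: T)
qed

end

section \<open>Constructing class preserving and central automorphisms\<close>

context group
begin

text \<open>A trivial kernel gives injectivity, and finiteness then gives surjectivity. The
  restriction is there because members of \<open>auto G\<close> are extensional.\<close>

lemma auto_of_injective_endomorphism:
  assumes fin: "finite (carrier G)" and F: "F \<in> hom G G"
    and inj: "\<And>x. x \<in> carrier G \<Longrightarrow> F x = \<one> \<Longrightarrow> x = \<one>"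
  shows "restrict F (carrier G) \<in> auto G"
proof -
  interpret F: group_hom G G F by unfold_locales (rule F)
  have "kernel G G F = {\<one>}"
    using inj by (auto simp: kernel_def)
  then have "inj_on F (carrier G)"
    using F.inj_iff_trivial_ker by blast
  moreover have "F ` carrier G \<subseteq> carrier G" by auto
  ultimately have "bij_betw F (carrier G) (carrier G)"
    using fin by (simp add: bij_betw_def endo_inj_surj)
  then show ?thesis
    by (auto simp: auto_def Bij_def hom_def Pi_iff cong: bij_betw_cong)
qed

lemma conjugation_in_class_preserving_auto:
  assumes fin: "finite (carrier G)" and g: "g \<in> carrier G"
  shows "(\<lambda>x\<in>carrier G. g \<otimes> x \<otimes> inv g) \<in> class_preserving_auto G"
proof -
  have "(\<lambda>x. g \<otimes> x \<otimes> inv g) \<in> hom G G"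
    using g by (auto intro!: homI simp: m_assoc)
  moreover have "x = \<one>" if "x \<in> carrier G" "g \<otimes> x \<otimes> inv g = \<one>" for x
  proof -
    have "inv g \<otimes> (g \<otimes> x \<otimes> inv g) \<otimes> g = \<one>" using that g by simp
    then show ?thesis using that(1) g by (simp add: m_assoc)
  qed
  ultimately have "(\<lambda>x\<in>carrier G. g \<otimes> x \<otimes> inv g) \<in> auto G"
    by (rule auto_of_injective_endomorphism[OF fin])
  then show ?thesis
    unfolding class_preserving_auto_def using g by (auto intro!: bexI[of _ "inv g"])
qed

text \<open>Injectivity needs testing on the center only: if
  \<open>x \<otimes> F x = \<one>\<close>, then \<open>x\<close> is the inverse of a central
  element.\<close>

lemma central_auto_of_hom:
  assumes fin: "finite (carrier G)" and F: "F \<in> hom G (G\<lparr>carrier := center G\<rparr>)"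
    and fix_free: "\<And>z. z \<in> center G \<Longrightarrow> z \<otimes> F z = \<one> \<Longrightarrow> z = \<one>"
  shows "(\<lambda>x\<in>carrier G. x \<otimes> F x) \<in> central_auto G"
proof -
  have FZ: "F x \<in> center G" if "x \<in> carrier G" for x
    using F that by (auto simp: hom_def)
  have F_mult: "F (x \<otimes> y) = F x \<otimes> F y" if "x \<in> carrier G" "y \<in> carrier G" for x y
    using F that by (auto simp: hom_def)
  note FG = center_carrier[OF FZ]
  have "(\<lambda>x. x \<otimes> F x) \<in> hom G G"
  proof (rule homI)
    fix x y assume x: "x \<in> carrier G" and y: "y \<in> carrier G"
    have "x \<otimes> y \<otimes> (F x \<otimes> F y) = x \<otimes> (F x \<otimes> y) \<otimes> F y"
      using x y FG center_commute[OF FZ[OF x] y] by (simp add: m_assoc)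
    then show "x \<otimes> y \<otimes> F (x \<otimes> y) = x \<otimes> F x \<otimes> (y \<otimes> F y)"
      using x y FG by (simp add: F_mult m_assoc)
  qed (use FG in simp)
  moreover have "x = \<one>" if x: "x \<in> carrier G" and eq: "x \<otimes> F x = \<one>" for x
  proof -
    have "x = inv (F x)" using inv_equality[OF eq] x FG by simp
    then have "x \<in> center G"
      using FZ[OF x] subgroup.m_inv_closed[OF subgroup_center] by metis
    then show ?thesis using fix_free eq by blast
  qed
  ultimately have "(\<lambda>x\<in>carrier G. x \<otimes> F x) \<in> auto G"
    by (rule auto_of_injective_endomorphism[OF fin])
  then show ?thesis
    unfolding central_auto_def using FZ FG by auto
qed

text \<open>Multiplicativity holds because the central factor
  \<open>inv x \<otimes> \<phi> x\<close> can be moved past \<open>inv y\<close>.\<close>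

lemma hom_of_central_auto:
  assumes "\<phi> \<in> central_auto G"
  shows "(\<lambda>x. inv x \<otimes> \<phi> x) \<in> hom G (G\<lparr>carrier := center G\<rparr>)"
proof (rule homI)
  have FZ: "inv x \<otimes> \<phi> x \<in> center G" if "x \<in> carrier G" for x
    using assms that by (simp add: central_auto_def)
  have hom: "\<phi> \<in> hom G G" using assms by (simp add: central_auto_def auto_def)
  then have G: "\<phi> x \<in> carrier G" if "x \<in> carrier G" for x
    using that by (auto simp: hom_def)
  fix x y assume x: "x \<in> carrier G" and y: "y \<in> carrier G"
  have "inv (x \<otimes> y) \<otimes> \<phi> (x \<otimes> y) = inv y \<otimes> (inv x \<otimes> \<phi> x) \<otimes> \<phi> y"
    using x y G hom_mult[OF hom x y] by (simp add: inv_mult_group m_assoc)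
  also have "\<dots> = (inv x \<otimes> \<phi> x) \<otimes> (inv y \<otimes> \<phi> y)"
    using x y G by (simp flip: center_commute[OF FZ[OF x]] add: m_assoc)
  finally show "inv (x \<otimes> y) \<otimes> \<phi> (x \<otimes> y) =
    (inv x \<otimes> \<phi> x) \<otimes>\<^bsub>G\<lparr>carrier := center G\<rparr>\<^esub> (inv y \<otimes> \<phi> y)" by simp
qed (use assms in \<open>simp add: central_auto_def\<close>)

section \<open>Cyclic subgroups, derived subgroup and class two\<close>

lemma finite_cyclic_subgroup_generator:
  assumes fin: "finite (carrier G)" and H: "subgroup H G"
    and cyc: "cyclic_group (G\<lparr>carrier := H\<rparr>)"
  obtains a where "a \<in> H" "ord a = card H" "H = range (\<lambda>i::nat. a [^] i)"
proof -
  obtain a where a: "a \<in> H"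
    and range: "H = range (\<lambda>n::int. a [^]\<^bsub>G\<lparr>carrier := H\<rparr>\<^esub> n)"
    using group.cyclic_group[OF subgroup_imp_group[OF H]] cyc by auto
  have eq: "H = range (\<lambda>n::int. a [^] n)"
    using range unfolding int_pow_consistent[OF H a, symmetric] .
  have aG: "a \<in> carrier G" using a subgroup.subset[OF H] by auto
  have gen: "generate G {a} = H"
    using eq unfolding generate_pow[OF aG] by blast
  have "ord a = card H" using generate_pow_card[OF aG] gen by simp
  moreover have "H = range (\<lambda>i::nat. a [^] i)"
    using generate_pow_on_finite_carrier[OF fin aG] unfolding gen by blast
  ultimately show ?thesis by (rule that[OF a])
qed

text \<open>Write \<open>card H = card S * q\<close> with a generator \<open>a\<close> of
  \<open>H\<close>. Every solution of \<open>y [^] card S = \<one>\<close> is a power of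
  \<open>a [^] q\<close>, so there are at most \<open>card S\<close> of them, and all elements of
  \<open>S\<close> are solutions.\<close>

lemma subgroup_of_cyclic_eq_roots:
  assumes fin: "finite (carrier G)" and H: "subgroup H G"
    and cyc: "cyclic_group (G\<lparr>carrier := H\<rparr>)"
    and S: "subgroup S G" "S \<subseteq> H"
  shows "S = {y \<in> H. y [^] card S = \<one>}"
proof -
  obtain a where a: "a \<in> H" "ord a = card H" and gen: "H = range (\<lambda>i::nat. a [^] i)"
    using finite_cyclic_subgroup_generator[OF fin H cyc] .
  have aG: "a \<in> carrier G" using a subgroup.subset[OF H] by auto
  have finS: "finite S" using fin S(1) by (meson finite_subset subgroup.subset)
  have m: "card S > 0" using finS subgroup.one_closed[OF S(1)] by (auto simp: card_gt_0_iff)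
  have "subgroup S (G\<lparr>carrier := H\<rparr>)"
    using S H by (simp add: subgroup_incl)
  then have "card S dvd card H"
    using group.lagrange[OF subgroup_imp_group[OF H], of S]
    by (simp add: order_def) (metis dvd_triv_right)
  then obtain q where q: "card H = card S * q" by blast
  let ?R = "{y \<in> H. y [^] card S = \<one>}"
  let ?b = "a [^] q"
  have b1: "?b [^] card S = \<one>"
    using pow_ord_eq_1[OF aG] aG a(2) q by (simp add: nat_pow_pow mult.commute)
  have "?R \<subseteq> (\<lambda>j. ?b [^] j) ` {..<card S}"
  proof
    fix y assume y: "y \<in> ?R"
    then obtain i :: nat where i: "y = a [^] i" using gen by blast
    have "a [^] (i * card S) = \<one>" using y i aG by (simp add: nat_pow_pow)
    then have "card S * q dvd i * card S" using pow_eq_id[OF aG] a(2) q by simp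
    then have "q dvd i" using m by (simp add: mult.commute)
    then obtain j where j: "i = q * j" by blast
    \<comment> \<open>Reducing the exponent modulo \<open>card S\<close> leaves only
      \<open>card S\<close> candidates for \<open>y\<close>.\<close>
    have "y = ?b [^] (card S * (j div card S) + j mod card S)"
      using i j aG by (simp only: nat_pow_pow mult_div_mod_eq)
    also have "\<dots> = (?b [^] card S) [^] (j div card S) \<otimes> ?b [^] (j mod card S)"
      by (simp only: nat_pow_mult nat_pow_pow nat_pow_closed aG distrib_left mult.assoc)
    also have "\<dots> = ?b [^] (j mod card S)"
      using aG by (simp add: b1)
    finally show "y \<in> (\<lambda>j. ?b [^] j) ` {..<card S}" using m by auto
  qed
  then have "card ?R \<le> card S"
    using surj_card_le[of "{..<card S}"] by simp
  moreover have "finite ?R"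
    using fin subgroup.subset[OF H] by (auto intro: finite_subset)
  moreover have "S \<subseteq> ?R" using S subgroup_pow_card by auto
  ultimately show ?thesis by (intro card_seteq) auto
qed

lemma hom_kills_derived:
  assumes A: "comm_group A" and h: "h \<in> hom G A" and c: "c \<in> derived G (carrier G)"
  shows "h c = \<one>\<^bsub>A\<^esub>"
proof -
  interpret A: comm_group A by fact
  interpret h: group_hom G A h by unfold_locales (rule h)
  have "commutator G x y \<in> kernel G A h" if x: "x \<in> carrier G" and y: "y \<in> carrier G" for x y
  proof -
    have "h (commutator G x y) \<otimes>\<^bsub>A\<^esub> h (y \<otimes> x) = h (x \<otimes> y)"
      using commutator_mult[OF x y] h.hom_mult[of "commutator G x y" "y \<otimes> x"] x y by simp
    also have "\<dots> = h (y \<otimes> x)" using x y by (simp add: A.m_comm)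
    finally have "h (commutator G x y) = \<one>\<^bsub>A\<^esub>"
      using x y by (metis A.l_one A.one_closed A.r_cancel commutator_closed h.hom_closed m_closed)
    then show ?thesis using x y by (simp add: kernel_def)
  qed
  then have "derived G (carrier G) \<subseteq> kernel G A h"
    using derived_subset_subgroup h.subgroup_kernel by blast
  then show ?thesis using c by (auto simp: kernel_def)
qed

text \<open>Conjugation by \<open>y\<close> is class preserving, hence central; evaluating this at
  \<open>inv x\<close> yields exactly \<open>commutator G x y\<close>.\<close>

lemma class_two_group_if_class_preserving_central:
  assumes fin: "finite (carrier G)" and sub: "class_preserving_auto G \<subseteq> central_auto G"
  shows "class_two_group G"
proof unfold_locales
  fix x y assume x: "x \<in> carrier G" and y: "y \<in> carrier G"
  have "(\<lambda>z\<in>carrier G. y \<otimes> z \<otimes> inv y) \<in> central_auto G"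
    using conjugation_in_class_preserving_auto[OF fin y] sub by blast
  then have "inv (inv x) \<otimes> (y \<otimes> inv x \<otimes> inv y) \<in> center G"
    unfolding central_auto_def using x y by (auto dest!: bspec[of _ _ "inv x"])
  then show "commutator G x y \<in> center G"
    using x y by (simp add: commutator_def m_assoc)
qed

end

section \<open>Commutator subgroups and power maps in class two\<close>

context class_two_group
begin

lemma derived_subset_center: "derived G (carrier G) \<subseteq> center G"
  by (rule derived_subset_subgroup[OF subgroup_center commutator_central])

text \<open>By bilinearity this is the image of the homomorphism
  \<open>commutator G x\<close>.\<close>

lemma subgroup_commutators:
  assumes x: "x \<in> carrier G"
  shows "subgroup (commutator G x ` carrier G) G"
proof (rule subgroupI)
  fix a b assume "a \<in> commutator G x ` carrier G" "b \<in> commutator G x ` carrier G"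
  then obtain g h where "g \<in> carrier G" "h \<in> carrier G"
    "a = commutator G x g" "b = commutator G x h" by blast
  then have "a \<otimes> b = commutator G x (g \<otimes> h)" "g \<otimes> h \<in> carrier G"
    using x by (simp_all add: commutator_mult_right)
  then show "a \<otimes> b \<in> commutator G x ` carrier G" by blast
next
  fix a assume "a \<in> commutator G x ` carrier G"
  then obtain g where g: "g \<in> carrier G" "a = commutator G x g" by blast
  have "commutator G x (inv g) \<otimes> commutator G x g = \<one>"
    using x g(1) by (simp flip: commutator_mult_right add: commutator_eq_one_iff)
  then have "inv a = commutator G x (inv g)"
    using x g by (simp add: inv_equality)
  then show "inv a \<in> commutator G x ` carrier G" using g(1) by blast
qed (use x in auto)

lemma pow_central:
  assumes "x \<in> carrier G" "\<And>g. g \<in> carrier G \<Longrightarrow> commutator G x g [^] (n::nat) = \<one>"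
  shows "x [^] n \<in> center G"
  using assms by (simp add: mem_center_iff commutator_pow_left)

text \<open>
  For \<open>T = k * (k - 1) div 2\<close> the correction term in \<open>pow_mult\<close> vanishes on the subgroup \<open>H\<close> of
  elements commuting with all \<open>T\<close>-th powers. It has order at most 2 everywhere, so \<open>H\<close> contains all
  squares. Since \<open>x [^] k\<close> is a central square root of \<open>(x \<otimes> x) [^] k\<close>, the power map on \<open>H\<close>
  extends to \<open>G\<close>.
\<close>

lemma ex_hom_extending_power:
  assumes fin: "finite (carrier G)"
  defines "k \<equiv> card (derived G (carrier G))"
  obtains F where "F \<in> hom G (G\<lparr>carrier := center G\<rparr>)" "\<And>z. z \<in> center G \<Longrightarrow> F z = z [^] k"
proof -
  let ?Z = "G\<lparr>carrier := center G\<rparr>"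
  define T where "T = k * (k - 1) div 2"
  define H where "H = {x \<in> carrier G. \<forall>g\<in>(\<lambda>g. g [^] T) ` carrier G. x \<otimes> g = g \<otimes> x}"
  have commutator_pow_k: "commutator G x y [^] k = \<one>" if "x \<in> carrier G" "y \<in> carrier G" for x y
    unfolding k_def
    by (rule subgroup_pow_card[OF derived_is_subgroup commutator_mem_derived[OF that]]) simp
  have pow_k: "x [^] k \<in> center G" if "x \<in> carrier G" for x
    by (rule pow_central[OF that]) (rule commutator_pow_k[OF that])
  have H: "subgroup H G"
    unfolding H_def by (rule subgroup_centralizer) auto
  have Z_H: "z \<in> H" if "z \<in> center G" for z
    using that by (auto simp: H_def center_def)
  have "(\<lambda>x. x [^] k) \<in> hom (G\<lparr>carrier := H\<rparr>) ?Z"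
  proof (rule homI)
    fix x assume "x \<in> carrier (G\<lparr>carrier := H\<rparr>)"
    then show "x [^] k \<in> carrier ?Z" using pow_k by (simp add: H_def)
  next
    fix x y assume "x \<in> carrier (G\<lparr>carrier := H\<rparr>)" "y \<in> carrier (G\<lparr>carrier := H\<rparr>)"
    then have x: "x \<in> carrier G" and y: "y \<in> carrier G" and c: "x \<otimes> y [^] T = y [^] T \<otimes> x"
      by (auto simp: H_def)
    have "commutator G y x [^] T = \<one>"
      using x y c by (simp flip: commutator_pow_left add: commutator_eq_one_iff)
    then show "(x \<otimes>\<^bsub>G\<lparr>carrier := H\<rparr>\<^esub> y) [^] k = x [^] k \<otimes>\<^bsub>?Z\<^esub> y [^] k"
      using pow_mult[OF x y, of k] x y by (simp add: T_def)
  qed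
  moreover have "commutator G x y \<in> H \<and> commutator G x y [^] k = \<one>\<^bsub>?Z\<^esub>"
    if "x \<in> carrier G" "y \<in> carrier G" for x y
    using that commutator_pow_k Z_H commutator_central by simp
  moreover have "x \<otimes> x \<in> H \<and> (\<exists>t\<in>carrier ?Z. (x \<otimes> x) [^] k = t \<otimes>\<^bsub>?Z\<^esub> t)"
    if x: "x \<in> carrier G" for x
  proof
    \<comment> \<open>Evenness ensures that the division in \<open>T\<close> is exact, so
      \<open>T + T\<close> is a multiple of \<open>k\<close> and kills every commutator.\<close>
    have even_k: "even (k * (k - 1))" by (cases "even k") auto
    have "x \<otimes> x \<otimes> g [^] T = g [^] T \<otimes> (x \<otimes> x)" if g: "g \<in> carrier G" for g
    proof -
      have "commutator G (g [^] T) (x \<otimes> x) = commutator G g x [^] (T + T)"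
        using x g by (simp add: commutator_mult_right commutator_pow_left nat_pow_mult)
      also have "T + T = k * (k - 1)" unfolding T_def using even_k by (simp flip: mult_2)
      also have "commutator G g x [^] (k * (k - 1)) = (commutator G g x [^] k) [^] (k - 1)"
        using x g by (simp add: nat_pow_pow)
      also have "\<dots> = \<one>" using x g commutator_pow_k by simp
      finally show ?thesis using x g by (simp add: commutator_eq_one_iff)
    qed
    then show "x \<otimes> x \<in> H" using x by (auto simp: H_def)
    have "(x \<otimes> x) [^] k = x [^] k \<otimes> x [^] k"
      using x pow_mult[OF x x, of k] commutator_eq_one_iff[OF x x] by simp
    then show "\<exists>t\<in>carrier ?Z. (x \<otimes> x) [^] k = t \<otimes>\<^bsub>?Z\<^esub> t"
      using pow_k[OF x] by auto
  qed
  ultimately obtain F where "F \<in> hom G ?Z" "\<forall>h\<in>H. F h = h [^] k"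
    using hom_extend_squares[OF comm_group_center fin H, of "\<lambda>x. x [^] k"] by blast
  then show ?thesis using Z_H that by blast
qed

section \<open>The two directions of the theorem\<close>

text \<open>If \<open>\<alpha> x\<close> is a conjugate of \<open>x\<close>, then
  \<open>inv x \<otimes> \<alpha> x\<close> is itself a commutator.\<close>

lemma class_preserving_auto_subset_central_auto:
  "class_preserving_auto G \<subseteq> central_auto G"
proof
  fix \<alpha> assume \<alpha>: "\<alpha> \<in> class_preserving_auto G"
  have "inv x \<otimes> \<alpha> x \<in> center G" if x: "x \<in> carrier G" for x
  proof -
    obtain g where g: "g \<in> carrier G" "\<alpha> x = inv g \<otimes> x \<otimes> g"
      using \<alpha> x by (auto simp: class_preserving_auto_def)
    then have "inv x \<otimes> \<alpha> x = commutator G (inv x) (inv g)"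
      using x by (simp add: commutator_def m_assoc)
    then show ?thesis using x g commutator_central by simp
  qed
  then show "\<alpha> \<in> central_auto G"
    using \<alpha> by (simp add: class_preserving_auto_def central_auto_def)
qed

lemma central_auto_subset_class_preserving_auto:
  assumes fin: "finite (carrier G)" and cyc: "cyclic_group (G\<lparr>carrier := center G\<rparr>)"
    and Z: "center G = derived G (carrier G)"
  shows "central_auto G \<subseteq> class_preserving_auto G"
proof
  fix \<phi> assume \<phi>: "\<phi> \<in> central_auto G"
  let ?Z = "G\<lparr>carrier := center G\<rparr>" and ?f = "\<lambda>x. inv x \<otimes> \<phi> x"
  have f: "?f \<in> hom G ?Z" by (rule hom_of_central_auto[OF \<phi>])
  have \<phi>G: "\<phi> x \<in> carrier G" if "x \<in> carrier G" for x
    using \<phi> that by (auto simp: central_auto_def auto_def hom_def)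
  have "\<exists>g\<in>carrier G. \<phi> x = inv g \<otimes> x \<otimes> g" if x: "x \<in> carrier G" for x
  proof -
    let ?S = "commutator G x ` carrier G"
    have S: "subgroup ?S G" by (rule subgroup_commutators[OF x])
    have SZ: "?S \<subseteq> center G" using commutator_central[OF x] by blast
    have "x [^] card ?S \<in> center G"
      by (rule pow_central[OF x]) (rule subgroup_pow_card[OF S], simp)
    then have "?f (x [^] card ?S) = \<one>"
      using hom_kills_derived[OF comm_group_center f] Z by simp
    moreover have "?f (x [^] card ?S) = ?f x [^]\<^bsub>?Z\<^esub> card ?S"
      by (rule hom_nat_pow[OF f x is_group subgroup_imp_group[OF subgroup_center]])
    ultimately have "?f x [^] card ?S = \<one>" by (simp flip: nat_pow_consistent)
    moreover have "?f x \<in> center G" using \<phi> x by (simp add: central_auto_def)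
    ultimately have "?f x \<in> ?S"
      using subgroup_of_cyclic_eq_roots[OF fin subgroup_center cyc S SZ] by blast
    \<comment> \<open>Passing to the inverse swaps the arguments of the commutator:
      \<open>commutator G g x \<otimes> x\<close> is the conjugate
      \<open>g \<otimes> x \<otimes> inv g\<close>.\<close>
    then have "inv (?f x) \<in> ?S" by (rule subgroup.m_inv_closed[OF S])
    then obtain g where g: "g \<in> carrier G" and eq: "inv (?f x) = commutator G x g" by blast
    have "?f x = commutator G g x"
      using x g \<phi>G eq inv_commutator[OF x g] by (metis inv_inv inv_closed m_closed)
    then have "commutator G g x \<otimes> x = ?f x \<otimes> x" by simp
    also have "\<dots> = \<phi> x"
      using x \<phi>G center_commute[OF \<open>?f x \<in> center G\<close> x] by (simp flip: m_assoc)
    finally have "\<phi> x = g \<otimes> x \<otimes> inv g"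
      using x g by (simp add: commutator_def m_assoc)
    then show ?thesis using g by (intro bexI[of _ "inv g"]) auto
  qed
  then show "\<phi> \<in> class_preserving_auto G"
    using \<phi> by (simp add: class_preserving_auto_def central_auto_def)
qed

lemma center_subset_derived:
  assumes p: "Factorial_Ring.prime (p::nat)" and ord: "order G = p ^ n" and nab: "\<not> comm_group G"
    and cyc: "cyclic_group (G\<lparr>carrier := center G\<rparr>)"
    and sub: "central_auto G \<subseteq> class_preserving_auto G"
  shows "center G \<subseteq> derived G (carrier G)"
proof -
  let ?D = "derived G (carrier G)"
  define k where "k = card ?D"
  have fin: "finite (carrier G)"
    using ord p order_gt_0_iff_finite prime_gt_0_nat by simp
  have D: "subgroup ?D G" by (rule derived_is_subgroup) simp
  have finD: "finite ?D" using fin finite_subset subgroup.subset[OF D] by blast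
  have "?D \<noteq> {\<one>}"
  proof
    assume "?D = {\<one>}"
    then have "x \<otimes> y = y \<otimes> x" if "x \<in> carrier G" "y \<in> carrier G" for x y
      using commutator_mem_derived[OF that] that by (simp add: commutator_eq_one_iff)
    then show False using nab group_comm_groupI by blast
  qed
  moreover have "k dvd p ^ n"
    using lagrange[OF D] ord by (metis dvd_triv_right k_def)
  ultimately have "p dvd k"
  proof -
    \<comment> \<open>A divisor of a power of \<open>p\<close> is a power of \<open>p\<close>; being
      different from 1, it is divisible by \<open>p\<close>.\<close>
    obtain i where i: "k = p ^ i" using \<open>k dvd p ^ n\<close> divides_primepow_nat[OF p] by blast
    have "k \<noteq> 1"
      using \<open>?D \<noteq> {\<one>}\<close> subgroup.one_closed[OF D] by (auto simp: k_def card_1_singleton_iff)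
    then show ?thesis using i by (cases i) auto
  qed
  then have cop: "coprime (k + 1) (p ^ n)"
    using p by (metis coprime_power_right_iff coprime_commute coprime_Suc_right_nat Suc_eq_plus1 coprime_divisors dvd_refl)
  obtain F where F: "F \<in> hom G (G\<lparr>carrier := center G\<rparr>)"
    and FZ: "\<And>z. z \<in> center G \<Longrightarrow> F z = z [^] k"
    unfolding k_def using ex_hom_extending_power[OF fin] by blast
  \<comment> \<open>On the center the map is \<open>z \<mapsto> z [^] (k + 1)\<close>, and its
    exponent is coprime to the group order.\<close>
  have "z = \<one>" if z: "z \<in> center G" "z \<otimes> F z = \<one>" for z
  proof -
    have zG: "z \<in> carrier G" using z(1) by (rule center_carrier)
    have "z [^] (k + 1) = \<one>"
      using z zG FZ nat_pow_Suc2[of z k] by simp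
    then have "ord z dvd k + 1" using pow_eq_id[OF zG] by blast
    moreover have "ord z dvd p ^ n" using ord_dvd_group_order[OF zG] ord by simp
    ultimately have "ord z = 1" using cop by (metis coprime_common_divisor_nat)
    then show ?thesis using ord_eq_1[OF zG] by blast
  qed
  then have "(\<lambda>x\<in>carrier G. x \<otimes> F x) \<in> class_preserving_auto G"
    using central_auto_of_hom[OF fin F] sub by blast
  then have fixed: "\<exists>g\<in>carrier G. z \<otimes> F z = inv g \<otimes> z \<otimes> g" if "z \<in> center G" for z
    using center_carrier[OF that] by (auto simp: class_preserving_auto_def)
  obtain a where a: "a \<in> center G" "ord a = card (center G)"
    using finite_cyclic_subgroup_generator[OF fin subgroup_center cyc] by blast
  have aG: "a \<in> carrier G" using a(1) by (rule center_carrier)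
  obtain g where g: "g \<in> carrier G" "a \<otimes> F a = inv g \<otimes> a \<otimes> g"
    using fixed[OF a(1)] by blast
  then have "a \<otimes> F a = a"
    using center_commute[OF a(1)] aG by (simp add: m_assoc)
  then have "a [^] k = \<one>"
    using aG FZ[OF a(1)] l_cancel_one by simp
  then have "card (center G) dvd k" using pow_eq_id[OF aG] a(2) by simp
  moreover have "k > 0"
    using finD subgroup.one_closed[OF D] by (auto simp: k_def card_gt_0_iff)
  \<comment> \<open>Together with the inclusion of the derived subgroup in the center, this bound
    forces equality.\<close>
  ultimately have "card (center G) \<le> card ?D" by (simp add: dvd_imp_le k_def)
  moreover have "finite (center G)"
    using fin finite_subset subgroup.subset[OF subgroup_center] by blast
  ultimately show ?thesis
    using card_seteq[OF _ derived_subset_center] by simp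
qed

end

theorem theorem3p4:
  fixes G :: "('a, 'b) monoid_scheme" and p :: nat
  assumes "Factorial_Ring.prime p"
    and "group G"
    and "finite (carrier G)"
    and "\<exists>n. order G = p ^ n"
    and "\<not> comm_group G"
    and "cyclic_group (G\<lparr>carrier := center G\<rparr>)"
  shows "class_preserving_auto G = central_auto G \<longleftrightarrow> center G = derived G (carrier G)"
proof -
  interpret group G by fact
  show ?thesis
  proof
    assume eq: "class_preserving_auto G = central_auto G"
    then interpret class_two_group G
      by (intro class_two_group_if_class_preserving_central assms(3)) simp
    obtain n where "order G = p ^ n" using assms(4) by blast
    then have "center G \<subseteq> derived G (carrier G)"
      using center_subset_derived[OF assms(1) _ assms(5,6)] eq by simp
    then show "center G = derived G (carrier G)" using derived_subset_center by blast
  next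
    assume Z: "center G = derived G (carrier G)"
    interpret class_two_group G
      by unfold_locales (simp add: Z commutator_mem_derived)
    show "class_preserving_auto G = central_auto G"
      using class_preserving_auto_subset_central_auto
        central_auto_subset_class_preserving_auto[OF assms(3,6) Z] by blast
  qed
qed

end
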